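(* Let $A$ and $B$ be C$^*$-algebras, where $A$ is unital with unit $1$, and let $T:A\to B$ be a linear map satisfying: (a) for all $a,b\in A$, $ab^*=1$ implies $T(a)T(b)^*=T(1)$; (b) for all $c,d\in A$, $c^*d=0$ implies $T(c)^*T(d)=0$. Then $T$ is a $^*$-homomorphism. *)

theory Defs
  imports "HOL-Analysis.Analysis"
begin

definition cstar_algebra ::
  "(complex \<Rightarrow> 'a::{banach, real_normed_algebra} \<Rightarrow> 'a) \<Rightarrow> ('a \<Rightarrow> 'a) \<Rightarrow> bool" where
  "cstar_algebra sc st \<longleftrightarrow>
     (\<forall>r x. sc (complex_of_real r) x = scaleR r x) \<and>
     (\<forall>a b x. sc (a * b) x = sc a (sc b x)) \<and>
     (\<forall>x. sc 1 x = x) \<and>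
     (\<forall>a x y. sc a (x + y) = sc a x + sc a y) \<and>
     (\<forall>a b x. sc (a + b) x = sc a x + sc b x) \<and>
     (\<forall>a x y. sc a x * y = sc a (x * y)) \<and>
     (\<forall>a x y. x * sc a y = sc a (x * y)) \<and>
     (\<forall>a x. norm (sc a x) = cmod a * norm x) \<and>
     (\<forall>x. st (st x) = x) \<and>
     (\<forall>x y. st (x + y) = st x + st y) \<and>
     (\<forall>a x. st (sc a x) = sc (cnj a) (st x)) \<and>
     (\<forall>x y. st (x * y) = st y * st x) \<and>
     (\<forall>x. norm (st x * x) = (norm x)^2)"

definition complex_linear_map ::
  "(complex \<Rightarrow> 'a::{banach, real_normed_algebra} \<Rightarrow> 'a) \<Rightarrow>
   (complex \<Rightarrow> 'b::{banach, real_normed_algebra} \<Rightarrow> 'b) \<Rightarrow> ('a \<Rightarrow> 'b) \<Rightarrow> bool" where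
  "complex_linear_map scA scB T \<longleftrightarrow>
     (\<forall>x y. T (x + y) = T x + T y) \<and> (\<forall>c x. T (scA c x) = scB c (T x))"

definition star_homomorphism ::
  "(complex \<Rightarrow> 'a::{banach, real_normed_algebra} \<Rightarrow> 'a) \<Rightarrow> ('a \<Rightarrow> 'a) \<Rightarrow>
   (complex \<Rightarrow> 'b::{banach, real_normed_algebra} \<Rightarrow> 'b) \<Rightarrow> ('b \<Rightarrow> 'b) \<Rightarrow> ('a \<Rightarrow> 'b) \<Rightarrow> bool" where
  "star_homomorphism scA stA scB stB T \<longleftrightarrow>
     complex_linear_map scA scB T \<and>
     (\<forall>x y. T (x * y) = T x * T y) \<and>
     (\<forall>x. T (stA x) = stB (T x))"

end

theory Submission
  imports Defs "HOL-Computational_Algebra.Polynomial"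
begin

text \<open>Put \<open>p = T 1\<close>. Condition (a) gives \<open>T u (T u)\<^sup>* = p\<close> for unitary \<open>u\<close>; hence \<open>p\<close> is a projection,
  \<open>p T u = T u\<close> and \<open>norm (T u) \<le> 1\<close>. Unitaries span the algebra, so \<open>T\<close> is bounded and \<open>p T x = T x\<close>
  for all \<open>x\<close>.

  Fix \<open>a\<close> and let \<open>E x = T (x a) - T x T a\<close>. By (b), \<open>x\<^sup>* y = 0\<close> implies \<open>(E x)\<^sup>* E y = 0\<close>, and
  \<open>E 1 = 0\<close>. For self-adjoint \<open>h\<close> with \<open>norm h < 1\<close> and \<open>-1 \<le> t \<le> 1\<close>, let \<open>F t = E ((h - t)\<^sub>+)\<close>, so
  \<open>E ((h - t)\<^sub>-) = F t - E h\<close>. For \<open>s \<le> t\<close> the product \<open>(h - t)\<^sub>+ (h - s)\<^sub>-\<close> vanishes, whence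
  \<open>(F s - F t)\<^sup>* (F s - F t) = (F s)\<^sup>* F s - (F t)\<^sup>* F t\<close>. The left-hand side is \<open>O((s - t)\<^sup>2)\<close>, so
  \<open>(F t)\<^sup>* F t\<close> is constant in \<open>t\<close>; it vanishes at \<open>t = 1\<close> and equals \<open>(E h)\<^sup>* E h\<close> at \<open>t = -1\<close>. Thus
  \<open>E = 0\<close> and \<open>T\<close> is multiplicative. Finally
  \<open>T (u\<^sup>*) = T (u\<^sup>*) p = T (u\<^sup>*) T u (T u)\<^sup>* = p (T u)\<^sup>* = (T u)\<^sup>*\<close>.

  The positive parts come from a functional calculus on \<open>C[-1,1]\<close>, obtained by uniform approximation
  from polynomials \<open>q\<close> with \<open>norm (q(h)) \<le> sup |q|\<close>. For the latter write \<open>h = (u + u\<^sup>*)/2\<close> with \<open>u\<close>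
  unitary: then \<open>q(h)\<close> is a Laurent polynomial in \<open>u\<close> whose coefficients are Fourier coefficients of
  \<open>q(cos \<theta>)\<close>, hence bounded by \<open>sup |q|\<close>.\<close>

subsection \<open>Real polynomials evaluated in an algebra\<close>

definition peval :: "real poly \<Rightarrow> 'a::real_algebra_1 \<Rightarrow> 'a" where
  "peval p x = (\<Sum>i\<le>degree p. coeff p i *\<^sub>R x ^ i)"

lemma peval_eq_sum:
  assumes "degree p \<le> n"
  shows "peval p x = (\<Sum>i\<le>n. coeff p i *\<^sub>R x ^ i)"
  unfolding peval_def using assms
  by (intro sum.mono_neutral_left) (auto simp: coeff_eq_0)

lemma peval_0 [simp]: "peval 0 x = 0"
  by (simp add: peval_def)

lemma peval_pCons [simp]: "peval (pCons c p) x = of_real c + x * peval p x"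
proof -
  have "peval (pCons c p) x = (\<Sum>i\<le>Suc (degree p). coeff (pCons c p) i *\<^sub>R x ^ i)"
    by (rule peval_eq_sum) (simp add: degree_pCons_le)
  also have "\<dots> = of_real c + (\<Sum>i\<le>degree p. coeff p i *\<^sub>R x ^ Suc i)"
    by (subst sum.atMost_Suc_shift) (simp add: of_real_def)
  also have "(\<Sum>i\<le>degree p. coeff p i *\<^sub>R x ^ Suc i) = x * peval p x"
    by (simp add: peval_def sum_distrib_left)
  finally show ?thesis .
qed

lemma peval_1 [simp]: "peval 1 x = 1"
  by (simp add: one_pCons)

lemma peval_of_real: "peval p (of_real x :: 'a::real_algebra_1) = of_real (poly p x)"
  by (induction p) auto

lemma peval_add [simp]: "peval (p + q) x = peval p x + peval q x"
  by (induction p q rule: poly_induct2) (auto simp: algebra_simps)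

lemma peval_smult [simp]: "peval (smult c p) x = c *\<^sub>R peval p x"
  by (induction p) (auto simp: algebra_simps of_real_def)

lemma peval_diff [simp]: "peval (p - q) x = peval p x - peval q x"
  using peval_add[of "p - q" q x] by (simp del: peval_add)

lemma peval_mult [simp]: "peval (p * q) x = peval p x * peval q x"
  by (induction p) (auto simp: algebra_simps scaleR_conv_of_real)

lemma peval_power [simp]: "peval (p ^ n) x = peval p x ^ n"
  by (induction n) auto

lemma peval_sum [simp]: "peval (sum p I) x = (\<Sum>i\<in>I. peval (p i) x)"
  by (induction I rule: infinite_finite_induct) auto

lemma peval_monom [simp]: "peval (monom c n) x = c *\<^sub>R x ^ n"
  by (induction n) (auto simp: monom_0 monom_Suc of_real_def)

text \<open>Discrete Fourier inversion: averaging \<open>z ^ (N - n) * peval p z\<close> over the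
  \<open>N\<close>-th roots of unity, with \<open>N\<close> larger than the degree, returns the
  \<open>n\<close>-th coefficient exactly, and every summand has norm at most
  \<open>M\<close>.\<close>

lemma abs_coeff_le_sup_circle:
  assumes M: "\<And>z::complex. norm z = 1 \<Longrightarrow> norm (peval p z) \<le> M"
  shows "\<bar>coeff p n\<bar> \<le> M"
proof (cases "n \<le> degree p")
  case False
  have "0 \<le> M"
    using M[of 1] norm_ge_zero order_trans by (metis norm_one)
  then show ?thesis
    using False by (simp add: coeff_eq_0)
next
  case True
  define N where "N = Suc (degree p)"
  define w :: complex where "w = exp (2 * of_real pi * \<i> / of_nat N)"
  have N: "n < N" "1 \<le> N"
    using True by (auto simp: N_def)
  have w_power: "w ^ j = exp (2 * of_real pi * \<i> * of_nat j / of_nat N)" for j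
    by (simp add: w_def flip: exp_of_nat_mult) (simp add: algebra_simps)
  have w1: "w ^ j = 1 \<longleftrightarrow> N dvd j" for j
    using complex_root_unity_eq_1[of N j] N by (simp add: w_power)
  have nw: "norm w = 1"
    by (simp add: w_def)
  have geo: "(\<Sum>k<N. (w ^ j) ^ k) = (if N dvd j then of_nat N else 0)" for j
  proof (cases "N dvd j")
    case True
    then have "w ^ j = 1" by (simp add: w1)
    then show ?thesis using True by simp
  next
    case False
    then have "w ^ j \<noteq> 1" by (simp add: w1)
    moreover have "(w ^ j) ^ N = 1"
      using w1[of "j * N"] by (simp add: power_mult)
    ultimately show ?thesis using False by (simp add: geometric_sum)
  qed
  \<comment> \<open>The exponent \<open>N - n\<close> stands for \<open>-n\<close>, since
    \<open>w ^ N = 1\<close>. As \<open>i + (N - n)\<close> lies strictly between 0 and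
    \<open>2 * N\<close>, the only multiple of \<open>N\<close> it can equal is \<open>N\<close>
    itself.\<close>
  have dvd: "N dvd i + (N - n) \<longleftrightarrow> i = n" if "i \<le> degree p" for i
  proof
    assume "N dvd i + (N - n)"
    then obtain c where c: "i + (N - n) = N * c" by blast
    have "0 < N * c" "N * c < N * 2"
      using c that N by (auto simp: N_def)
    then have "c = 1"
      by simp
    then show "i = n" using c N by simp
  next
    assume "i = n"
    then show "N dvd i + (N - n)" using N by simp
  qed
  have "(\<Sum>k<N. (w ^ k) ^ (N - n) * peval p (w ^ k))
      = (\<Sum>k<N. \<Sum>i\<le>degree p. coeff p i *\<^sub>R (w ^ (i + (N - n))) ^ k)"
    unfolding peval_def sum_distrib_left
    by (intro sum.cong refl) (simp add: power_add power_mult_distrib mult_ac flip: power_mult)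
  also have "\<dots> = (\<Sum>i\<le>degree p. coeff p i *\<^sub>R (\<Sum>k<N. (w ^ (i + (N - n))) ^ k))"
    by (subst sum.swap) (simp add: scaleR_sum_right)
  also have "\<dots> = (\<Sum>i\<le>degree p. if i = n then coeff p i *\<^sub>R of_nat N else 0)"
    using dvd by (intro sum.cong refl) (simp add: geo)
  also have "\<dots> = coeff p n *\<^sub>R of_nat N"
    using True by (simp add: sum.delta)
  finally have "norm (coeff p n *\<^sub>R of_nat N :: complex)
      \<le> (\<Sum>k<N. norm ((w ^ k) ^ (N - n) * peval p (w ^ k)))"
    by (metis norm_sum)
  also have "\<dots> \<le> (\<Sum>k<N. M)"
    by (intro sum_mono) (simp add: norm_mult norm_power nw M)
  finally have "\<bar>coeff p n\<bar> * N \<le> M * N"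
    by (simp add: mult.commute)
  then show ?thesis using N by simp
qed

text \<open>The substitution \<open>x = (u + u\<^sup>-\<^sup>1)/2\<close>, cleared of the denominator \<open>u\<^sup>d\<close>.\<close>

definition joukowski_poly :: "real poly \<Rightarrow> real poly" where
  "joukowski_poly q = (\<Sum>k\<le>degree q.
     smult (coeff q k) (monom 1 (degree q - k) * (monom (1/2) 2 + [:1/2:]) ^ k))"

lemma degree_joukowski_poly: "degree (joukowski_poly q) \<le> 2 * degree q"
  unfolding joukowski_poly_def
proof (rule degree_sum_le)
  fix k assume k: "k \<in> {..degree q}"
  have d: "degree (monom (1/2) 2 + [:1/2:] :: real poly) \<le> 2"
    by (intro degree_add_le) (auto simp: degree_monom_le)
  have "degree ((monom (1/2) 2 + [:1/2:] :: real poly) ^ k) \<le> 2 * k"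
    using degree_power_le[of "monom (1/2) 2 + [:1/2:] :: real poly" k] d
    by (meson mult_le_mono1 order_trans)
  moreover have "degree (monom 1 (degree q - k) :: real poly) \<le> degree q - k"
    by (rule degree_monom_le)
  ultimately have "degree (monom 1 (degree q - k) * (monom (1/2) 2 + [:1/2:] :: real poly) ^ k)
      \<le> degree q - k + 2 * k"
    by (meson add_mono degree_mult_le order_trans)
  then show "degree (smult (coeff q k) (monom 1 (degree q - k) * (monom (1/2) 2 + [:1/2:]) ^ k))
      \<le> 2 * degree q"
    using k degree_smult_le[of "coeff q k"
      "monom 1 (degree q - k) * (monom (1/2) 2 + [:1/2:]) ^ k"] by simp
qed simp

text \<open>The second hypothesis is \<open>x = (u + 1/u)/2\<close> multiplied through by
  \<open>2 * u\<close>, so that complex numbers on the circle and unitaries are covered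
  alike.\<close>

lemma peval_joukowski_poly:
  fixes u x :: "'a::real_algebra_1"
  assumes comm: "u * x = x * u" and eq: "2 *\<^sub>R (u * x) = u\<^sup>2 + 1"
  shows "peval (joukowski_poly q) u = u ^ degree q * peval q x"
proof -
  have half: "(1/2) *\<^sub>R u\<^sup>2 + of_real (1/2) = u * x"
  proof -
    have "(1/2) *\<^sub>R u\<^sup>2 + of_real (1/2) = (1/2) *\<^sub>R (u\<^sup>2 + 1)"
      by (simp add: scaleR_add_right of_real_def)
    then show ?thesis by (simp flip: eq)
  qed
  have pw: "(u * x) ^ k = u ^ k * x ^ k" for k
  proof (induction k)
    case (Suc k)
    have "x * u ^ k = u ^ k * x"
      by (metis comm power_commuting_commutes)
    then show ?case
      using Suc by (simp add: mult.assoc) (metis mult.assoc)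
  qed simp
  have "peval (joukowski_poly q) u
      = (\<Sum>k\<le>degree q. coeff q k *\<^sub>R (u ^ (degree q - k) * (u * x) ^ k))"
    using half by (simp add: joukowski_poly_def)
  also have "\<dots> = (\<Sum>k\<le>degree q. coeff q k *\<^sub>R (u ^ degree q * x ^ k))"
    by (intro sum.cong refl) (simp add: pw flip: mult.assoc power_add)
  finally show ?thesis
    by (simp add: peval_def sum_distrib_left)
qed

text \<open>On the unit circle the substituted variable is \<open>Re z\<close>, which lies in the
  interval, and the factor \<open>z ^ degree q\<close> has modulus 1.\<close>

lemma abs_coeff_joukowski_poly_le:
  assumes M: "\<And>x. x \<in> {-1..1} \<Longrightarrow> \<bar>poly q x\<bar> \<le> M"
  shows "\<bar>coeff (joukowski_poly q) n\<bar> \<le> M"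
proof (rule abs_coeff_le_sup_circle)
  fix z :: complex assume z: "norm z = 1"
  have "z * cnj z = 1"
    using z by (metis complex_norm_square of_real_1 one_power2)
  moreover have "2 * complex_of_real (Re z) = z + cnj z"
    by (simp add: complex_add_cnj)
  ultimately have "2 *\<^sub>R (z * of_real (Re z)) = z\<^sup>2 + 1"
    by (simp add: scaleR_conv_of_real power2_eq_square algebra_simps)
  then have "peval (joukowski_poly q) z = z ^ degree q * of_real (poly q (Re z))"
    using peval_joukowski_poly[of z "of_real (Re z)" q] by (simp add: peval_of_real mult.commute)
  moreover have "Re z \<in> {-1..1}"
    using abs_Re_le_cmod[of z] z by auto
  ultimately show "norm (peval (joukowski_poly q) z) \<le> M"
    using M[of "Re z"] z by (simp add: norm_mult norm_power)
qed

subsection \<open>C*-algebras\<close>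

locale cstar =
  fixes sc :: "complex \<Rightarrow> 'a::{banach, real_normed_algebra} \<Rightarrow> 'a" and st :: "'a \<Rightarrow> 'a"
  assumes cstar_algebra: "cstar_algebra sc st"
begin

lemma
  shows sc_of_real: "sc (of_real r) x = r *\<^sub>R x"
    and sc_sc: "sc a (sc b x) = sc (a * b) x"
    and sc_one [simp]: "sc 1 x = x"
    and sc_add_right: "sc a (x + y) = sc a x + sc a y"
    and sc_mult_left [simp]: "sc a x * y = sc a (x * y)"
    and sc_mult_right [simp]: "x * sc a y = sc a (x * y)"
    and norm_sc [simp]: "norm (sc a x) = cmod a * norm x"
    and st_st [simp]: "st (st x) = x"
    and st_add [simp]: "st (x + y) = st x + st y"
    and st_sc [simp]: "st (sc a x) = sc (cnj a) (st x)"
    and st_mult [simp]: "st (x * y) = st y * st x"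
    and norm_st_mult_self: "norm (st x * x) = (norm x)\<^sup>2"
  using cstar_algebra unfolding cstar_algebra_def by metis+

lemma sc_minus_left: "sc (- c) x = - sc c x"
  using sc_sc[of "-1" c x] sc_of_real[of "-1" "sc c x"] by simp

lemma sc_minus_right: "sc c (- x) = - sc c x"
  using sc_sc[of c "-1" x] sc_of_real[of "-1" x] by (simp add: sc_minus_left)

lemma sc_diff_right: "sc c (x - y) = sc c x - sc c y"
  using sc_add_right[of c x "- y"] by (simp add: sc_minus_right)

lemma st_scaleR [simp]: "st (r *\<^sub>R x) = r *\<^sub>R st x"
  using st_sc[of "of_real r" x] by (simp add: sc_of_real del: st_sc)

lemma linear_st: "linear st"
  by (intro linearI) auto

lemmas st_zero [simp] = linear_0[OF linear_st]
  and st_minus [simp] = linear_neg[OF linear_st]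
  and st_diff [simp] = linear_diff[OF linear_st]

lemma norm_le_norm_st: "norm x \<le> norm (st x)"
proof (cases "x = 0")
  case False
  have "norm x * norm x \<le> norm (st x) * norm x"
    using norm_mult_ineq[of "st x" x] by (simp add: norm_st_mult_self power2_eq_square)
  then show ?thesis using False by simp
qed simp

lemma norm_st [simp]: "norm (st x) = norm x"
  using norm_le_norm_st[of x] norm_le_norm_st[of "st x"] by simp

lemma norm_mult_st_self: "norm (x * st x) = (norm x)\<^sup>2"
  using norm_st_mult_self[of "st x"] by simp

lemma st_mult_self_eq_0_iff [simp]: "st x * x = 0 \<longleftrightarrow> x = 0"
  using norm_st_mult_self[of x] by (metis mult_zero_right norm_eq_zero power_eq_0_iff)

lemma mult_st_self_eq_0_iff [simp]: "x * st x = 0 \<longleftrightarrow> x = 0"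
  using st_mult_self_eq_0_iff[of "st x"] by (metis st_st st_zero)

lemma bounded_linear_st: "bounded_linear st"
  by (rule bounded_linear_intro[where K = 1]) auto

lemma cartesian_decomposition:
  obtains a b where "st a = a" "st b = b" "x = a + sc \<i> b" "norm a \<le> norm x" "norm b \<le> norm x"
proof
  define a where "a = (1/2) *\<^sub>R (x + st x)"
  define b where "b = sc (- \<i> / 2) (x - st x)"
  show "st a = a"
    by (simp add: a_def add.commute)
  show "st b = b"
  proof -
    have "st b = sc (\<i> / 2) (- (x - st x))"
      by (simp add: b_def)
    then show ?thesis by (simp add: b_def sc_minus_left sc_minus_right flip: minus_divide_left del: minus_diff_eq)
  qed
  show "x = a + sc \<i> b"
  proof -
    have "sc \<i> b = sc (of_real (1/2)) (x - st x)"
      by (simp add: b_def sc_sc)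
    also have "\<dots> = (1/2) *\<^sub>R (x - st x)"
      by (rule sc_of_real)
    finally have "a + sc \<i> b = (1/2) *\<^sub>R (x + x)"
      by (simp add: a_def flip: scaleR_add_right)
    then show ?thesis
      by (metis scaleR_half_double)
  qed
  show "norm a \<le> norm x"
    using norm_triangle_ineq[of x "st x"] by (simp add: a_def)
  show "norm b \<le> norm x"
    using norm_triangle_ineq4[of x "st x"] by (simp add: b_def norm_divide)
qed

text \<open>The increments of \<open>F\<close> behave like those of an orthogonal martingale, so the squares of
  their norms, rather than the norms, add up.\<close>

lemma orthogonal_increments_bound:
  assumes orth: "\<And>i j. i \<le> j \<Longrightarrow> j \<le> N \<Longrightarrow> st (F j) * (F i - e) = 0"
    and F0: "F 0 = e" and FN: "F N = 0"
    and d: "\<And>i. i < N \<Longrightarrow> norm (F i - F (Suc i)) \<le> d"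
  shows "(norm e)\<^sup>2 \<le> real N * d\<^sup>2"
proof -
  have incr: "st (F i - F (Suc i)) * (F i - F (Suc i)) = st (F i) * F i - st (F (Suc i)) * F (Suc i)"
    if "i < N" for i
  proof -
    define a b where "a = F i" and "b = F (Suc i)"
    \<comment> \<open>Orthogonality gives \<open>st b * a = st b * e = st b * b\<close>; the adjoint
      equation treats the other cross term.\<close>
    have "st b * (a - e) = 0" "st b * (b - e) = 0"
      using orth[of i "Suc i"] orth[of "Suc i" "Suc i"] that by (auto simp: a_def b_def)
    then have ba: "st b * a = st b * b"
      by (simp add: right_diff_distrib)
    then have "st (st b * a) = st (st b * b)" by simp
    then have "st a * b = st b * b" by simp
    with ba show ?thesis
      unfolding a_def[symmetric] b_def[symmetric] by (simp add: algebra_simps)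
  qed
  have "st e * e = (\<Sum>i<N. st (F i) * F i - st (F (Suc i)) * F (Suc i))"
    using sum_lessThan_telescope'[of "\<lambda>i. st (F i) * F i" N] by (simp add: F0 FN)
  then have "(norm e)\<^sup>2 = norm (\<Sum>i<N. st (F i - F (Suc i)) * (F i - F (Suc i)))"
    by (simp only: norm_st_mult_self[symmetric]) (simp add: incr del: st_diff)
  also have "\<dots> \<le> (\<Sum>i<N. (norm (F i - F (Suc i)))\<^sup>2)"
    by (rule order_trans[OF norm_sum]) (simp only: norm_st_mult_self order_refl)
  also have "\<dots> \<le> (\<Sum>i<N. d\<^sup>2)"
    by (intro sum_mono power_mono) (auto intro: d)
  finally show ?thesis by simp
qed

end

section \<open>Unitaries and norm bounds for polynomials in a self-adjoint element\<close>

locale unital_cstar = cstar sc st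
  for sc :: "complex \<Rightarrow> 'a::{banach, real_normed_algebra_1} \<Rightarrow> 'a" and st :: "'a \<Rightarrow> 'a"
begin

lemma st_one [simp]: "st 1 = 1"
  by (metis mult_1_right mult_1_left st_mult st_st)

lemma st_power [simp]: "st (x ^ n) = st x ^ n"
  by (induction n) (simp_all add: power_commutes)

definition unitary :: "'a \<Rightarrow> bool" where
  "unitary u \<longleftrightarrow> st u * u = 1 \<and> u * st u = 1"

lemma unitary_st: "unitary u \<Longrightarrow> unitary (st u)"
  by (simp add: unitary_def)

lemma norm_power_unitary:
  assumes "unitary u" shows "norm (u ^ n * x) = norm x"
proof (induction n)
  case (Suc n)
  have "norm (u * y) = norm y" for y
  proof -
    have "norm (u * y) ^ 2 = norm (st y * (st u * u) * y)"
      using norm_st_mult_self[of "u * y"] by (simp add: mult.assoc)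
    also have "\<dots> = norm y ^ 2"
      using assms by (simp add: unitary_def norm_st_mult_self)
    finally show ?thesis by simp
  qed
  then show ?case using Suc by (simp add: mult.assoc)
qed simp

text \<open>With \<open>1 - w\<close> for the root, the equation reads \<open>w = (x + w\<^sup>2)/2\<close>, whose right-hand side
  contracts the ball of radius \<open>norm x\<close>.\<close>

lemma exists_sqrt_one_minus:
  assumes x: "st x = x" "norm x < 1" and h: "h * x = x * h"
  obtains s where "st s = s" "s * h = h * s" "s * s = 1 - x"
proof -
  define r where "r = norm x"
  \<comment> \<open>Self-adjointness and commutation with \<open>h\<close> are closed conditions
    preserved by \<open>f\<close>, so building them into \<open>S\<close> passes them to the fixed
    point.\<close>
  define S where "S = cball 0 r \<inter> {w. st w = w} \<inter> {w. w * h = h * w}"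
  define f where "f w = (1/2) *\<^sub>R (x + w * w)" for w
  have r: "0 \<le> r" "r < 1" using x by (auto simp: r_def)
  have "continuous_on UNIV st"
    by (rule linear_continuous_on[OF bounded_linear_st])
  then have "closed {w. st w = w}"
    by (intro closed_Collect_eq) (auto intro!: continuous_intros)
  moreover have "closed {w. w * h = h * w}"
    by (intro closed_Collect_eq continuous_intros)
  ultimately have "closed S"
    by (auto simp: S_def)
  then have "complete S" by (simp add: complete_eq_closed)
  moreover have "0 \<in> S" using r by (auto simp: S_def)
  moreover have "f ` S \<subseteq> S"
  proof safe
    fix w assume w: "w \<in> S"
    have "norm (w * w) \<le> r * 1"
      using w r by (intro order_trans[OF norm_mult_ineq] mult_mono) (auto simp: S_def)
    then have "norm (f w) \<le> r"
      using norm_triangle_ineq[of x "w * w"] by (simp add: f_def r_def)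
    moreover have "w * w * h = h * (w * w)"
      using w by (simp add: S_def mult.assoc) (simp flip: mult.assoc)
    then have "f w * h = h * f w"
      using h by (simp add: f_def algebra_simps)
    ultimately show "f w \<in> S"
      using w x by (auto simp: S_def f_def)
  qed
  moreover have "dist (f v) (f w) \<le> r * dist v w" if "v \<in> S" "w \<in> S" for v w
  proof -
    have "f v - f w = (1/2) *\<^sub>R (v * (v - w) + (v - w) * w)"
      by (simp add: f_def algebra_simps)
    then have "norm (f v - f w) \<le> (1/2) * (norm v * norm (v - w) + norm (v - w) * norm w)"
      using norm_triangle_ineq[of "v * (v - w)" "(v - w) * w"]
        norm_mult_ineq[of v "v - w"] norm_mult_ineq[of "v - w" w] by simp
    also have "\<dots> \<le> (1/2) * (r * norm (v - w) + norm (v - w) * r)"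
      using that by (intro mult_left_mono add_mono mult_right_mono) (auto simp: S_def)
    finally show ?thesis by (simp add: dist_norm)
  qed
  ultimately obtain w where w: "w \<in> S" "f w = w"
    using Banach_fix[of S r f] r by blast
  show ?thesis
  proof
    show "st (1 - w) = 1 - w" "(1 - w) * h = h * (1 - w)"
      using w by (auto simp: S_def algebra_simps)
    have "x + w * w = 2 *\<^sub>R w"
      by (subst w(2)[symmetric]) (simp add: f_def)
    then show "(1 - w) * (1 - w) = 1 - x"
      by (simp add: algebra_simps scaleR_2)
  qed
qed

text \<open>Take \<open>u = h + sc \<i> s\<close> with \<open>s\<close> a self-adjoint square root
  of \<open>1 - h * h\<close>. It is unitary because \<open>s\<close> commutes with
  \<open>h\<close>.\<close>

lemma exists_unitary_real_part:
  assumes h: "st h = h" "norm h < 1"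
  obtains u where "unitary u" "h = (1/2) *\<^sub>R (u + st u)"
proof -
  have "norm (h * h) < 1"
    using norm_st_mult_self[of h] h by (simp add: power_less_one_iff)
  then obtain s where s: "st s = s" "s * h = h * s" "s * s = 1 - h * h"
    using h exists_sqrt_one_minus[of "h * h" h] by (auto simp: mult.assoc)
  define u where "u = h + sc \<i> s"
  have ii: "sc \<i> (sc \<i> y) = - y" for y
    using sc_of_real[of "-1" y] by (simp add: sc_sc)
  have st_u: "st u = h - sc \<i> s"
    by (simp add: u_def h s sc_minus_left)
  have "unitary u"
    unfolding unitary_def st_u unfolding u_def by (simp add: algebra_simps s ii sc_diff_right sc_add_right)
  moreover have "h = (1/2) *\<^sub>R (u + st u)"
    by (simp add: st_u) (simp add: u_def)
  ultimately show ?thesis by (rule that)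
qed

text \<open>Every element is a linear combination of unitaries: split it into self-adjoint parts and
  scale each into the open unit ball, where it is the real part of a unitary.\<close>

lemma unitary_span_induct:
  assumes U: "\<And>u. unitary u \<Longrightarrow> P u"
    and add: "\<And>x y. P x \<Longrightarrow> P y \<Longrightarrow> P (x + y)"
    and sc: "\<And>c x. P x \<Longrightarrow> P (sc c x)"
  shows "P x"
proof -
  have sa: "P a" if a: "st a = a" for a
  proof -
    define r where "r = norm a + 1"
    have r: "r > 0" by (simp add: r_def add_nonneg_pos)
    have "st ((1/r) *\<^sub>R a) = (1/r) *\<^sub>R a" "norm ((1/r) *\<^sub>R a) < 1"
      using r by (simp_all add: a) (simp add: r_def field_simps)
    then obtain u where u: "unitary u" "(1/r) *\<^sub>R a = (1/2) *\<^sub>R (u + st u)"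
      by (rule exists_unitary_real_part)
    have "a = r *\<^sub>R ((1/r) *\<^sub>R a)" using r by simp
    also have "\<dots> = sc (of_real (r / 2)) (u + st u)"
      by (simp only: u(2) sc_of_real) simp
    finally show ?thesis
      using u(1) by (metis U add sc unitary_st)
  qed
  obtain a b where "st a = a" "st b = b" "x = a + sc \<i> b"
    by (rule cartesian_decomposition)
  then show ?thesis
    by (simp add: add sc sa)
qed

text \<open>Up to a power of \<open>u\<close>, which preserves norms, \<open>peval q h\<close> is a
  sum of \<open>2 * degree q + 1\<close> terms, each of norm at most \<open>M\<close>.\<close>

lemma norm_peval_le_degree:
  fixes M :: real
  assumes h: "st h = h" "norm h < 1" and M: "\<And>x. x \<in> {-1..1} \<Longrightarrow> \<bar>poly q x\<bar> \<le> M"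
  shows "norm (peval q h) \<le> (2 * degree q + 1) * M"
proof -
  obtain u where u: "unitary u" and hu: "h = (1/2) *\<^sub>R (u + st u)"
    using exists_unitary_real_part[OF h] .
  have "u * h = h * u" "2 *\<^sub>R (u * h) = u\<^sup>2 + 1"
    using u by (simp_all add: hu unitary_def algebra_simps power2_eq_square)
  then have "norm (peval q h) = norm (peval (joukowski_poly q) u)"
    by (simp add: peval_joukowski_poly norm_power_unitary[OF u])
  also have "\<dots> \<le> (\<Sum>i\<le>2 * degree q. norm (coeff (joukowski_poly q) i *\<^sub>R u ^ i))"
    unfolding peval_eq_sum[OF degree_joukowski_poly] by (rule norm_sum)
  also have "\<dots> \<le> (\<Sum>i\<le>2 * degree q. M)"
  proof (rule sum_mono)
    fix i
    have "norm (u ^ i) = 1"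
      using norm_power_unitary[OF u, of i 1] by simp
    then show "norm (coeff (joukowski_poly q) i *\<^sub>R u ^ i) \<le> M"
      using abs_coeff_joukowski_poly_le[OF M, of i] by simp
  qed
  finally show ?thesis by (simp add: algebra_simps)
qed

lemma st_peval [simp]:
  assumes "st h = h" shows "st (peval q h) = peval q h"
  using assms by (simp add: peval_def linear_sum[OF linear_st])

lemma norm_power_two_power:
  assumes "st x = x" shows "norm (x ^ (2 ^ k)) = norm x ^ (2 ^ k)"
proof (induction k)
  case (Suc k)
  have "norm (x ^ (2 ^ Suc k)) = norm (st (x ^ (2 ^ k)) * x ^ (2 ^ k))"
    using assms by (simp add: mult_2 flip: power_add)
  also have "\<dots> = norm x ^ (2 ^ Suc k)"
    by (simp only: norm_st_mult_self Suc) (simp add: mult.commute flip: power_mult)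
  finally show ?case .
qed simp

text \<open>Applying the bound with the spurious factor to high powers of \<open>q\<close> removes that factor.\<close>

lemma norm_peval_le:
  fixes M :: real
  assumes h: "st h = h" "norm h < 1" and M: "\<And>x. x \<in> {-1..1} \<Longrightarrow> \<bar>poly q x\<bar> \<le> M"
    and "M > 0"
  shows "norm (peval q h) \<le> M"
proof (rule ccontr)
  assume "\<not> norm (peval q h) \<le> M"
  define r where "r = norm (peval q h) / M"
  have r: "r > 1" using \<open>\<not> _\<close> \<open>M > 0\<close> by (simp add: r_def)
  define d where "d = real (degree q)"
  have bound: "r ^ (2 ^ k) \<le> 2 * d * real (2 ^ k) + 1" for k :: nat
  proof -
    have "norm (peval q h) ^ (2 ^ k) = norm (peval (q ^ (2 ^ k)) h)"
      by (simp add: norm_power_two_power h)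
    also have "\<dots> \<le> (2 * degree (q ^ (2 ^ k)) + 1) * M ^ (2 ^ k)"
      by (rule norm_peval_le_degree[OF h]) (use M in \<open>auto simp: power_abs intro!: power_mono\<close>)
    also have "\<dots> \<le> (2 * d * real (2 ^ k) + 1) * M ^ (2 ^ k)"
    proof (rule mult_right_mono)
      have "real (degree (q ^ (2 ^ k))) \<le> d * real (2 ^ k)"
        using degree_power_le[of q "2 ^ k"] by (metis d_def of_nat_le_iff of_nat_mult)
      then show "real (2 * degree (q ^ (2 ^ k)) + 1) \<le> 2 * d * real (2 ^ k) + 1"
        by simp
    qed (use \<open>M > 0\<close> in simp)
    finally show ?thesis
      using \<open>M > 0\<close> by (simp add: r_def power_divide field_simps)
  qed
  \<comment> \<open>Since \<open>r > 1\<close>, the power \<open>r ^ m\<close> outgrows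
    \<open>2 * d * m + 1\<close>. The quotient is a null sequence, later read off at
    \<open>m = 2 ^ n\<close>.\<close>
  have "norm (1 / r) < 1"
    using r by simp
  then have "(\<lambda>n. 2 * d * (real n * (1 / r) ^ n) + (1 / r) ^ n) \<longlonglongrightarrow> 2 * d * 0 + 0"
    by (intro tendsto_add tendsto_mult_left powser_times_n_limit_0 LIMSEQ_power_zero)
  then have "eventually (\<lambda>n. 2 * d * (real n * (1 / r) ^ n) + (1 / r) ^ n < 1) sequentially"
    by (rule order_tendstoD) simp
  then obtain n where n: "\<And>m. m \<ge> n \<Longrightarrow> 2 * d * (real m * (1 / r) ^ m) + (1 / r) ^ m < 1"
    by (auto simp: eventually_sequentially)
  have "2 * d * (real (2 ^ n) * (1 / r) ^ (2 ^ n)) + (1 / r) ^ (2 ^ n) < 1"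
    by (rule n) (simp add: less_imp_le)
  then have "2 * d * real (2 ^ n) + 1 < r ^ (2 ^ n)"
    using r by (simp add: power_divide field_simps)
  then show False using bound[of n] by simp
qed

subsection \<open>Functional calculus on the interval\<close>

text \<open>A relation, since the approximating polynomials are not canonical; that \<open>b\<close>
  depends only on \<open>f\<close> on the interval follows from
  \<open>fcalc_norm_le\<close>.\<close>

definition fcalc :: "'a \<Rightarrow> (real \<Rightarrow> real) \<Rightarrow> 'a \<Rightarrow> bool" where
  "fcalc h f b \<longleftrightarrow> (\<exists>p. uniform_limit {-1..1} (\<lambda>n. poly (p n)) f sequentially \<and>
     (\<lambda>n. peval (p n) h) \<longlonglongrightarrow> b)"

lemma fcalc_peval: "fcalc h (poly p) (peval p h)"
  unfolding fcalc_def by (rule exI[of _ "\<lambda>_. p"]) (auto intro: uniform_limit_const)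

lemma fcalc_norm_le:
  assumes h: "st h = h" "norm h < 1" and f: "fcalc h f b"
    and M: "\<And>x. x \<in> {-1..1} \<Longrightarrow> \<bar>f x\<bar> \<le> M"
  shows "norm b \<le> M"
proof (rule field_le_epsilon)
  fix e :: real assume e: "e > 0"
  obtain p where p: "uniform_limit {-1..1} (\<lambda>n. poly (p n)) f sequentially"
    and lim: "(\<lambda>n. peval (p n) h) \<longlonglongrightarrow> b"
    using f by (auto simp: fcalc_def)
  have "M \<ge> 0" using M[of 0] by simp
  have "eventually (\<lambda>n. norm (peval (p n) h) \<le> M + e) sequentially"
    using uniform_limitD[OF p e]
  proof (rule eventually_mono)
    fix n assume n: "\<forall>x\<in>{-1..1}. dist (poly (p n) x) (f x) < e"
    show "norm (peval (p n) h) \<le> M + e"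
    proof (rule norm_peval_le[OF h])
      fix x :: real assume "x \<in> {-1..1}"
      then show "\<bar>poly (p n) x\<bar> \<le> M + e"
        using n M[of x] by (fastforce simp: dist_real_def)
    qed (use e \<open>M \<ge> 0\<close> in simp)
  qed
  then show "norm b \<le> M + e"
    using tendsto_upperbound[OF tendsto_norm[OF lim]] by simp
qed

lemma fcalc_diff:
  assumes "fcalc h f b" "fcalc h g c"
  shows "fcalc h (\<lambda>x. f x - g x) (b - c)"
proof -
  obtain p q where "uniform_limit {-1..1} (\<lambda>n. poly (p n)) f sequentially"
    "(\<lambda>n. peval (p n) h) \<longlonglongrightarrow> b" "uniform_limit {-1..1} (\<lambda>n. poly (q n)) g sequentially"
    "(\<lambda>n. peval (q n) h) \<longlonglongrightarrow> c"
    using assms by (auto simp: fcalc_def)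
  then show ?thesis unfolding fcalc_def
    by (intro exI[of _ "\<lambda>n. p n - q n"]) (auto simp: poly_diff[abs_def] intro: tendsto_diff uniform_limit_minus)
qed

lemma fcalc_mult:
  assumes "fcalc h f b" "fcalc h g c" and "continuous_on {-1..1} f" "continuous_on {-1..1} g"
  shows "fcalc h (\<lambda>x. f x * g x) (b * c)"
proof -
  obtain p q where "uniform_limit {-1..1} (\<lambda>n. poly (p n)) f sequentially"
    "(\<lambda>n. peval (p n) h) \<longlonglongrightarrow> b" "uniform_limit {-1..1} (\<lambda>n. poly (q n)) g sequentially"
    "(\<lambda>n. peval (q n) h) \<longlonglongrightarrow> c"
    using assms by (auto simp: fcalc_def)
  moreover have "bounded (f ` {-1..1})" "bounded (g ` {-1..1})"
    using assms(3,4) by (auto intro!: compact_imp_bounded compact_continuous_image)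
  ultimately show ?thesis unfolding fcalc_def
    by (intro exI[of _ "\<lambda>n. p n * q n"]) (auto simp: poly_mult[abs_def] intro: tendsto_mult uniform_lim_mult)
qed

lemma fcalc_st:
  assumes "st h = h" "fcalc h f b"
  shows "st b = b"
proof -
  obtain p where "(\<lambda>n. peval (p n) h) \<longlonglongrightarrow> b"
    using assms by (auto simp: fcalc_def)
  moreover from this have "(\<lambda>n. st (peval (p n) h)) \<longlonglongrightarrow> st b"
    by (rule bounded_linear.tendsto[OF bounded_linear_st])
  ultimately show ?thesis
    using assms(1) by (auto dest: LIMSEQ_unique)
qed

text \<open>Weierstrass approximation supplies the polynomials, and \<open>norm_peval_le\<close>
  turns their uniform closeness into a Cauchy sequence in the algebra.\<close>

lemma fcalc_exists:
  assumes h: "st h = h" "norm h < 1" and f: "continuous_on {-1..1} f"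
  obtains b where "fcalc h f b"
proof -
  have "\<exists>p. \<forall>x\<in>{-1..1}. \<bar>f x - poly p x\<bar> < e" if e: "e > 0" for e
  proof -
    obtain g where g: "real_polynomial_function g" "\<And>x. x \<in> {-1..1} \<Longrightarrow> \<bar>f x - g x\<bar> < e"
      using Stone_Weierstrass_real_polynomial_function[OF compact_Icc f e] by blast
    then obtain a n where "g = (\<lambda>x. \<Sum>i\<le>n. a i * x ^ i)"
      by (auto simp: real_polynomial_function_iff_sum)
    then have "g = poly (\<Sum>i\<le>n. monom (a i) i)"
      by (auto simp: poly_sum poly_monom)
    then show ?thesis using g by (metis (full_types))
  qed
  then have "\<exists>p. \<forall>x\<in>{-1..1}. \<bar>f x - poly p x\<bar> < inverse (real (Suc n))" for n
    by simp
  then obtain p where p: "\<And>n x. x \<in> {-1..1} \<Longrightarrow> \<bar>f x - poly (p n) x\<bar> < inverse (real (Suc n))"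
    by metis
  have unif: "uniform_limit {-1..1} (\<lambda>n. poly (p n)) f sequentially"
  proof (rule uniform_limitI)
    fix e :: real assume "e > 0"
    then have "eventually (\<lambda>n. inverse (real (Suc n)) < e) sequentially"
      using LIMSEQ_inverse_real_of_nat by (rule order_tendstoD(2)[rotated])
    then show "\<forall>\<^sub>F n in sequentially. \<forall>x\<in>{-1..1}. dist (poly (p n) x) (f x) < e"
      by (rule eventually_mono)
        (auto simp: dist_real_def abs_minus_commute intro: less_trans[OF p])
  qed
  have "Cauchy (\<lambda>n. peval (p n) h)"
  proof (rule CauchyI)
    fix e :: real assume e: "e > 0"
    then obtain N where N: "\<And>n x. n \<ge> N \<Longrightarrow> x \<in> {-1..1} \<Longrightarrow> dist (poly (p n) x) (f x) < e / 4"
      using uniform_limitD[OF unif, of "e / 4"] unfolding eventually_sequentially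
      by (metis zero_less_divide_iff zero_less_numeral)
    have "norm (peval (p m) h - peval (p n) h) < e" if "m \<ge> N" "n \<ge> N" for m n
    proof -
      have "norm (peval (p m - p n) h) \<le> e / 2"
      proof (rule norm_peval_le[OF h])
        fix x :: real assume "x \<in> {-1..1}"
        then show "\<bar>poly (p m - p n) x\<bar> \<le> e / 2"
          using N[OF that(1), of x] N[OF that(2), of x]
          unfolding dist_real_def poly_diff by linarith
      qed (use e in simp)
      then show ?thesis using e by simp
    qed
    then show "\<exists>M. \<forall>m\<ge>M. \<forall>n\<ge>M. norm (peval (p m) h - peval (p n) h) < e" by blast
  qed
  then obtain b where "(\<lambda>n. peval (p n) h) \<longlonglongrightarrow> b"
    using Cauchy_convergent by (auto simp: convergent_def)
  then show ?thesis using unif that by (auto simp: fcalc_def)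
qed

text \<open>\<open>x i\<close> and \<open>y i\<close> are the positive and negative parts of
  \<open>h - t i\<close>, where the grid \<open>t i\<close> runs from -1 at \<open>i = 0\<close> to
  1 at \<open>i = N\<close> in steps of \<open>2 / N\<close>. The last bound holds because
  \<open>max (r - t) 0\<close> is 1-Lipschitz in \<open>t\<close>.\<close>

lemma exists_positive_parts:
  assumes h: "st h = h" "norm h < 1" and N: "N > 0"
  obtains x y :: "nat \<Rightarrow> 'a" where
    "\<And>i j. i \<le> j \<Longrightarrow> st (x j) * y i = 0"
    "\<And>i. x i - y i = h - (2 * real i / real N - 1) *\<^sub>R 1"
    "y 0 = 0" "x N = 0"
    "\<And>i. norm (x i - x (Suc i)) \<le> 2 / real N"
proof -
  define t where "t i = 2 * real i / real N - 1" for i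
  define f where "f i r = max (r - t i) 0" for i r
  define g where "g i r = max (t i - r) 0" for i r
  have cont: "continuous_on {-1..1} (f i)" "continuous_on {-1..1} (g i)" for i
    unfolding f_def g_def by (intro continuous_intros)+
  have "\<exists>b. fcalc h (f i) b" "\<exists>b. fcalc h (g i) b" for i
    using fcalc_exists[OF h cont(1)] fcalc_exists[OF h cont(2)] by metis+
  then obtain x y where x: "\<And>i. fcalc h (f i) (x i)" and y: "\<And>i. fcalc h (g i) (y i)"
    by metis
  \<comment> \<open>The difference represents a function vanishing on the interval, so the norm
    bound 0 applies.\<close>
  have unique: "b = c" if "fcalc h k b" "fcalc h l c" "\<And>r. r \<in> {-1..1} \<Longrightarrow> k r = l r" for b c k l
    using fcalc_norm_le[OF h fcalc_diff[OF that(1,2)], of 0] that(3) by simp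
  have zero: "fcalc h (\<lambda>_. 0) 0"
    using fcalc_peval[of h 0] by (simp add: poly_0[abs_def])
  show ?thesis
  proof
    show "st (x j) * y i = 0" if "i \<le> j" for i j
    proof -
      have "t i \<le> t j" using that by (simp add: t_def divide_right_mono)
      then have "f j r * g i r = 0" for r by (auto simp: f_def g_def max_def)
      then have "x j * y i = 0"
        using unique[OF fcalc_mult[OF x y cont] zero] by simp
      then show ?thesis using fcalc_st[OF h(1) x] by simp
    qed
    show "x i - y i = h - (2 * real i / real N - 1) *\<^sub>R 1" for i
    proof (rule unique[OF fcalc_diff[OF x y]])
      show "fcalc h (poly [:- t i, 1:]) (h - (2 * real i / real N - 1) *\<^sub>R 1)"
        using fcalc_peval[of h "[:- t i, 1:]"] by (simp add: t_def of_real_def algebra_simps)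
    qed (auto simp: f_def g_def)
    show "y 0 = 0" "x N = 0"
      using N by (auto intro!: unique[OF y zero] unique[OF x zero] simp: f_def g_def t_def)
    show "norm (x i - x (Suc i)) \<le> 2 / real N" for i
    proof (rule fcalc_norm_le[OF h fcalc_diff[OF x x]])
      have "t (Suc i) = t i + 2 / real N" "0 \<le> 2 / real N"
        by (simp_all add: t_def add_divide_distrib)
      then show "\<bar>f i r - f (Suc i) r\<bar> \<le> 2 / real N" for r
        unfolding f_def by linarith
    qed
  qed
qed

end

subsection \<open>The theorem\<close>

theorem theorem2p9:
  fixes scA :: "complex \<Rightarrow> 'a::{banach, real_normed_algebra_1} \<Rightarrow> 'a"
    and stA :: "'a \<Rightarrow> 'a"
    and scB :: "complex \<Rightarrow> 'b::{banach, real_normed_algebra} \<Rightarrow> 'b"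
    and stB :: "'b \<Rightarrow> 'b"
    and T :: "'a \<Rightarrow> 'b"
  assumes "cstar_algebra scA stA"
    and "cstar_algebra scB stB"
    and "complex_linear_map scA scB T"
    and "\<And>a b. a * stA b = 1 \<Longrightarrow> T a * stB (T b) = T 1"
    and "\<And>c d. stA c * d = 0 \<Longrightarrow> stB (T c) * T d = 0"
  shows "star_homomorphism scA stA scB stB T"
proof -
  interpret A: unital_cstar scA stA by unfold_locales fact
  interpret B: cstar scB stB by unfold_locales fact
  have T_add: "T (x + y) = T x + T y" and T_sc: "T (scA c x) = scB c (T x)" for x y c
    using assms(3) by (auto simp: complex_linear_map_def)
  have T_scaleR: "T (r *\<^sub>R x) = r *\<^sub>R T x" for r x
    using T_sc[of "of_real r" x] by (simp add: A.sc_of_real B.sc_of_real)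
  have T_linear: "linear T"
    by (intro linearI T_add T_scaleR)
  note T_diff = linear_diff[OF T_linear] and T_0 = linear_0[OF T_linear]

  \<comment> \<open>The projection \<open>p\<close> and boundedness of \<open>T\<close>\<close>
  define p where "p = T 1"
  have T_unitary: "T u * stB (T u) = p" if "A.unitary u" for u
    using assms(4)[of u u] that by (simp add: A.unitary_def p_def)
  have pp: "p * stB p = p"
    using T_unitary[of 1] by (simp add: A.unitary_def p_def)
  then have p_st: "stB p = p"
    by (metis B.st_mult B.st_st)
  with pp have p_idem: "p * p = p" by simp
  have "norm p \<le> 1"
  proof (cases "p = 0")
    case False
    have "norm p * norm p = norm p"
      using B.norm_mult_st_self[of p] pp by (simp add: power2_eq_square)
    then show ?thesis using False by simp
  qed simp
  have norm_T_unitary: "norm (T u) \<le> 1" if "A.unitary u" for u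
    using B.norm_mult_st_self[of "T u"] T_unitary[OF that] \<open>norm p \<le> 1\<close>
    by (simp add: power_le_one_iff)
  have norm_T_sa: "norm (T h) \<le> 2 * norm h" if h: "stA h = h" for h
  proof (cases "h = 0")
    case False
    \<comment> \<open>Scaling to norm 1/2 makes \<open>k\<close> the real part of a unitary.\<close>
    define k where "k = (1 / (2 * norm h)) *\<^sub>R h"
    have "stA k = k" "norm k < 1" using h False by (auto simp: k_def)
    then obtain u where u: "A.unitary u" "k = (1/2) *\<^sub>R (u + stA u)"
      by (rule A.exists_unitary_real_part)
    have "norm (T k) \<le> 1"
      using norm_T_unitary[OF u(1)] norm_T_unitary[OF A.unitary_st[OF u(1)]]
        norm_triangle_ineq[of "T u" "T (stA u)"] by (simp add: u(2) T_scaleR T_add)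
    then show ?thesis
      using False by (simp add: k_def T_scaleR field_simps)
  qed (simp add: T_0)
  have norm_T: "norm (T x) \<le> 4 * norm x" for x
  proof -
    obtain a b where ab: "stA a = a" "stA b = b" "x = a + scA \<i> b"
        "norm a \<le> norm x" "norm b \<le> norm x"
      by (rule A.cartesian_decomposition)
    then show ?thesis
      using norm_T_sa[of a] norm_T_sa[of b] norm_triangle_ineq[of "T a" "scB \<i> (T b)"]
      by (simp add: T_add T_sc)
  qed
  have pT: "p * T x = T x" for x
  proof (induction x rule: A.unitary_span_induct)
    case (1 u)
    \<comment> \<open>\<open>T u * stB v\<close> equals \<open>p - p * p = 0\<close>, and
      multiplying by \<open>p\<close> on the left also kills \<open>p * T u * stB v\<close>; hence
      \<open>v * stB v = 0\<close>.\<close>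
    define v where "v = T u - p * T u"
    have "T u * stB v = T u * stB (T u) - T u * stB (T u) * p"
      by (simp add: v_def p_st algebra_simps)
    then have "T u * stB v = 0"
      by (simp add: T_unitary[OF 1] p_idem)
    then have "v * stB v = 0"
      by (simp add: v_def left_diff_distrib mult.assoc del: B.st_diff)
    then have "v = 0" by (simp only: B.mult_st_self_eq_0_iff)
    then show ?case by (simp add: v_def)
  qed (simp_all add: T_add T_sc distrib_left)

  \<comment> \<open>Multiplicativity\<close>
  have mult_sa: "T (h * a) = T h * T a" if h: "stA h = h" "norm h < 1" for h a
  proof -
    define E where "E x = T (x * a) - T x * T a" for x
    define C where "C = 4 * norm a + 4 * norm (T a)"
    have E_diff: "E (x - y) = E x - E y" for x y
      by (simp add: E_def T_diff algebra_simps)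
    have E_1: "E (r *\<^sub>R 1) = 0" for r
      using pT[of a] by (simp add: E_def T_scaleR p_def)
    have norm_E: "norm (E x) \<le> C * norm x" for x
    proof -
      have "norm (E x) \<le> norm (T (x * a)) + norm (T x * T a)"
        unfolding E_def by (rule norm_triangle_ineq4)
      also have "norm (T (x * a)) \<le> 4 * (norm x * norm a)"
        using norm_T[of "x * a"] norm_mult_ineq[of x a] by simp
      also have "norm (T x * T a) \<le> 4 * norm x * norm (T a)"
        using norm_mult_ineq[of "T x" "T a"] mult_right_mono[OF norm_T[of x], of "norm (T a)"] by simp
      finally show ?thesis by (simp add: C_def algebra_simps)
    qed
    have E_orth: "stB (E x) * E y = 0" if xy: "stA x * y = 0" for x y
    proof -
      \<comment> \<open>Right multiplication by \<open>a\<close> keeps the product zero, so (b)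
        kills each of the four terms of \<open>stB (E x) * E y\<close>.\<close>
      have "stA (x * a) * (y * a) = 0" "stA (x * a) * y = 0" "stA x * (y * a) = 0"
        using xy by (metis A.st_mult mult.assoc mult_zero_left mult_zero_right)+
      from this[THEN assms(5)] assms(5)[OF xy]
      have z: "stB (T (x * a)) * T (y * a) = 0" "stB (T (x * a)) * T y = 0"
        "stB (T x) * T (y * a) = 0" "stB (T x) * T y = 0" .
      have "stB (E x) * E y = stB (T (x * a)) * T (y * a) - stB (T (x * a)) * T y * T a
          - stB (T a) * (stB (T x) * T (y * a)) + stB (T a) * (stB (T x) * T y) * T a"
        by (simp add: E_def algebra_simps)
      then show ?thesis by (simp add: z)
    qed
    \<comment> \<open>With \<open>N\<close> grid steps each increment of \<open>E (x i)\<close> has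
      norm at most \<open>2 * C / N\<close>; the sum of the \<open>N\<close> squares is
      \<open>4 * C\<^sup>2 / N\<close>, which tends to 0.\<close>
    have bound: "(norm (E h))\<^sup>2 \<le> 4 * C\<^sup>2 * inverse (real (Suc n))" for n
    proof -
      define N where "N = Suc n"
      obtain x y where xy: "\<And>i j. i \<le> j \<Longrightarrow> stA (x j) * y i = 0"
          "\<And>i. x i - y i = h - (2 * real i / real N - 1) *\<^sub>R 1" "y 0 = 0" "x N = 0"
          "\<And>i. norm (x i - x (Suc i)) \<le> 2 / real N"
        using A.exists_positive_parts[OF h, of N] by (auto simp: N_def)
      \<comment> \<open>\<open>E\<close> vanishes on scalar multiples of 1, so the grid point drops
        out of \<open>x i - y i\<close>.\<close>
      have E_y: "E (y i) = E (x i) - E h" for i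
        using arg_cong[OF xy(2)[of i], of E] by (simp only: E_diff E_1) (simp add: algebra_simps)
      have "(norm (E h))\<^sup>2 \<le> real N * (C * (2 / real N))\<^sup>2"
      proof (rule B.orthogonal_increments_bound[where F = "\<lambda>i. E (x i)"])
        show "stB (E (x j)) * (E (x i) - E h) = 0" if "i \<le> j" for i j
          using E_orth[OF xy(1)[OF that]] by (simp only: E_y)
        show "E (x 0) = E h" "E (x N) = 0"
          using E_y[of 0] by (simp_all add: xy(3,4)) (simp_all add: E_def T_0)
        have "C \<ge> 0" by (simp add: C_def)
        then show "norm (E (x i) - E (x (Suc i))) \<le> C * (2 / real N)" for i
          using norm_E[of "x i - x (Suc i)"] mult_left_mono[OF xy(5)[of i], of C]
          unfolding E_diff by linarith
      qed
      also have "\<dots> = 4 * C\<^sup>2 * inverse (real N)"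
        using N_def by (simp add: power_mult_distrib power_divide)
          (simp add: power2_eq_square divide_inverse)
      finally show ?thesis by (simp add: N_def)
    qed
    have "(\<lambda>n. 4 * C\<^sup>2 * inverse (real (Suc n))) \<longlonglongrightarrow> 4 * C\<^sup>2 * 0"
      by (intro tendsto_intros LIMSEQ_inverse_real_of_nat)
    then have "(norm (E h))\<^sup>2 \<le> 4 * C\<^sup>2 * 0"
      by (rule LIMSEQ_le_const) (use bound in blast)
    then show ?thesis by (simp add: E_def)
  qed
  have mult: "T (x * y) = T x * T y" for x y
  proof (induction x rule: A.unitary_span_induct)
    case (1 u)
    have sa: "T (h * y) = T h * T y" if h: "stA h = h" for h
    proof -
      define r where "r = norm h + 1"
      have r: "r > 0" by (simp add: r_def add_nonneg_pos)
      have "T (((1/r) *\<^sub>R h) * y) = T ((1/r) *\<^sub>R h) * T y"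
        using r h by (intro mult_sa) (auto simp: r_def field_simps)
      then show ?thesis using r by (simp add: T_scaleR)
    qed
    obtain a b where "stA a = a" "stA b = b" "u = a + scA \<i> b"
      by (rule A.cartesian_decomposition)
    then show ?case
      by (simp add: sa T_add T_sc distrib_right)
  qed (simp_all add: T_add T_sc distrib_right)

  \<comment> \<open>Preservation of the involution\<close>
  have Tp: "T x * p = T x" for x
    using mult[of x 1] by (simp add: p_def)
  have star: "T (stA x) = stB (T x)" for x
  proof (induction x rule: A.unitary_span_induct)
    case (1 u)
    have "T (stA u) = T (stA u) * (T u * stB (T u))"
      by (simp add: T_unitary[OF 1] Tp)
    also have "\<dots> = T (stA u * u) * stB (T u)"
      by (simp add: mult mult.assoc)
    also have "\<dots> = p * stB (T u)"
      using 1 by (simp add: A.unitary_def p_def)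
    also have "\<dots> = stB (T u * p)"
      by (simp add: p_st)
    finally show ?case by (simp add: Tp)
  qed (simp_all add: T_add T_sc)
  show ?thesis
    using assms(3) mult star by (simp add: star_homomorphism_def)
qed

end
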